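(* Let $n \geq 2$ be an integer, and let $S$ be an ordering of the vertex set of $FJ(n,1)$ (all permutations of $(1,\ldots,n)$). Let $\overline{S}$ be the concatenation of $\phi_1(S), \phi_2(S), \ldots, \phi_{n+1}(S)$ in that order, a vertex ordering of $FJ(n+1,1)$. Then: 1. For all $i,j \in [n+1]$: if $|i-j| = 1$, then $A(FJ(n+1,1),\overline{S})[i,j]$ is the $n!\times n!$ identity matrix, and if $|i-j|>1$, then $A(FJ(n+1,1),\overline{S})[i,j]$ is the zero matrix. 2. For every $i \in [n+1]$, $A(FJ(n+1,1),\overline{S})[i,i]$ is the adjacency matrix with respect to $S$ of a regular subgraph of $FJ(n,1)$: if $i=1$ or $i=n+1$, this subgraph is $FJ(n,1)$ itself (which is regular of degree $n-1$); otherwise, it is the subgraph generated by excluding the $(i-1,i)$-transposition from the generating set of $FJ(n,1)$, i.e. the Cayley graph on $S_n$ generated by all $(x,x+1)$-transpositions with $x\in[n-1]$, $x \neq i-1$ (which is regular of degree $n-2$).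
   Context: Write $[m]=\{1,\ldots,m\}$. For a permutation $u=(u_1,\ldots,u_n)$ of $(1,2,\ldots,n)$ and $i \in [n]$ write $u(i) = \{u_1, u_2, \ldots, u_i\}$. For integers $0 \leq k < n$, the Full-Flag Johnson graph $FJ(n,k)$ has as vertex set all permutations of $(1,\ldots,n)$; two vertices $u,v$ are adjacent if and only if $u(i) \neq v(i)$ for exactly $k$ integers $i \in [n]$. The graph $FJ(n,1)$ is the order-$n$ permutahedron. For $x\in[n-1]$, the $(x,x+1)$-transposition is the operation on permutations $u=(u_1,\ldots,u_n)$ that interchanges the entries in positions $x$ and $x+1$. The Cayley graph on $S_n$ generated by a set $T$ of such transpositions has as vertices all permutations of $(1,\ldots,n)$, with $u$ and $v$ adjacent if and only if $v$ is obtained from $u$ by applying one element of $T$ ($T$ is a connection set and need not generate the group). $FJ(n,1)$ is the Cayley graph generated by all $(x,x+1)$-transpositions, $x\in[n-1]$. For $i \in [n+1]$, the insertion function $\phi_i$ sends a permutation $u=(u_1,\ldots,u_n)$ of $(1,\ldots,n)$ to the permutation $\phi_i(u) = (u_1,\ldots,u_{i-1},n+1,u_i,\ldots,u_n)$ of $(1,\ldots,n+1)$. If $S$ is a sequence of permutations, $\phi_i(S)$ is the sequence obtained by applying $\phi_i$ to each term. For a graph $G$ on $m$ vertices with vertex ordering $T=(v_1,\ldots,v_m)$, $A(G,T)$ is the $m\times m$ adjacency matrix whose $(i,j)$ entry is $1$ if $v_i$ and $v_j$ are adjacent in $G$ and $0$ otherwise. The $(n+1)!\times(n+1)!$ matrix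 $A(FJ(n+1,1),\overline{S})$ is divided into $(n+1)^2$ consecutive blocks of size $n!\times n!$; $A(FJ(n+1,1),\overline{S})[i,j]$ denotes the $(i,j)$th block, whose rows correspond to the vertices of $\phi_i(S)$ and columns to those of $\phi_j(S)$. *)

theory Defs
  imports
    "HOL-Combinatorics.Multiset_Permutations"
    "Graph_Theory.Graph_Theory"
    "Jordan_Normal_Form.DL_Submatrix"
begin

text \<open>
  A permutation \<open>(u\<^sub>1, \<dots>, u\<^sub>n)\<close> of \<open>(1, \<dots>, n)\<close> is the list of its entries, i.e. an element of
  \<^term>\<open>permutations_of_set {1..n}\<close>. Positions of permutations and blocks of matrices are counted
  from 1, whereas list and matrix indices start at 0.
\<close>

text \<open>
  \<^term>\<open>set (take i u)\<close> is \<open>u(i) = {u\<^sub>1, \<dots>, u\<^sub>i}\<close>. Undirected graphs are symmetric digraphs, so every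
  edge contributes both of its orientations.
\<close>

definition FJ :: "nat \<Rightarrow> nat \<Rightarrow> nat list pair_pre_digraph" where
  "FJ n k = \<lparr> pverts = permutations_of_set {1..n},
     parcs = {(u, v). u \<in> permutations_of_set {1..n} \<and> v \<in> permutations_of_set {1..n} \<and>
       card {i \<in> {1..n}. set (take i u) \<noteq> set (take i v)} = k} \<rparr>"

definition adj_transposition :: "nat \<Rightarrow> nat list \<Rightarrow> nat list" where
  "adj_transposition x u = u[x - 1 := u ! x, x := u ! (x - 1)]"

definition cayley_graph :: "nat \<Rightarrow> (nat list \<Rightarrow> nat list) set \<Rightarrow> nat list pair_pre_digraph" where
  "cayley_graph n T = \<lparr> pverts = permutations_of_set {1..n},
     parcs = {(u, v). u \<in> permutations_of_set {1..n} \<and> v \<in> permutations_of_set {1..n} \<and>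
       (\<exists>t \<in> T. v = t u)} \<rparr>"

definition insertion :: "nat \<Rightarrow> nat list \<Rightarrow> nat list" where
  "insertion i u = take (i - 1) u @ [length u + 1] @ drop (i - 1) u"

definition vertex_ordering :: "('a, 'b) pre_digraph \<Rightarrow> 'a list \<Rightarrow> bool" where
  "vertex_ordering G T \<longleftrightarrow> distinct T \<and> set T = verts G"

definition adjacency_matrix :: "('a, 'b) pre_digraph \<Rightarrow> 'a list \<Rightarrow> real mat" where
  "adjacency_matrix G T =
     mat (length T) (length T) (\<lambda>(i, j). if T ! i \<rightarrow>\<^bsub>G\<^esub> T ! j then 1 else 0)"

definition S_bar :: "nat \<Rightarrow> nat list list \<Rightarrow> nat list list" where
  "S_bar n S = concat (map (\<lambda>i. map (insertion i) S) [1..<n + 2])"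

definition block :: "nat \<Rightarrow> 'a mat \<Rightarrow> nat \<Rightarrow> nat \<Rightarrow> 'a mat" where
  "block m M i j = submatrix M {(i - 1) * m..<i * m} {(j - 1) * m..<j * m}"

text \<open>In a symmetric digraph the out-degree of a vertex is its number of neighbours.\<close>

definition regular_graph :: "('a, 'b) pre_digraph \<Rightarrow> nat \<Rightarrow> bool" where
  "regular_graph G d \<longleftrightarrow> graph G \<and> (\<forall>v \<in> verts G. out_degree G v = d)"

end

theory Submission
  imports Defs
begin

text \<open>
  For permutations \<open>u\<close>, \<open>v\<close> let \<open>D(u, v)\<close> be the set of those \<open>i\<close> with \<open>u(i) \<noteq> v(i)\<close>. Then
  \<open>D(u, v)\<close> is empty iff \<open>u = v\<close>, and \<open>D(u, v) = {x}\<close> iff \<open>v\<close> arises from \<open>u\<close> by the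
  \<open>(x, x + 1)\<close>-transposition. For \<open>i \<le> j\<close> the set \<open>D(\<phi>\<^sub>i(u), \<phi>\<^sub>j(v))\<close> consists of the elements of
  \<open>D(u, v)\<close> below \<open>i\<close>, of the whole interval from \<open>i\<close> to \<open>j - 1\<close> (where exactly one of the two
  initial segments contains \<open>n + 1\<close>), and of the successors of the elements of \<open>D(u, v)\<close> that are
  at least \<open>j - 1\<close>. So an element \<open>i - 1\<close> of \<open>D(u, v)\<close> is counted twice if \<open>i = j\<close>, which removes the
  \<open>(i - 1, i)\<close>-transposition from the diagonal block; if \<open>j = i + 1\<close>, the interval already
  contributes one element, which forces \<open>u = v\<close>; and if \<open>j > i + 1\<close>, there are too many elements.
\<close>

section \<open>Initial segments of permutations and adjacent transpositions\<close>

definition flag_diff :: "'a list \<Rightarrow> 'a list \<Rightarrow> nat set" where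
  "flag_diff u v = {i. set (take i u) \<noteq> set (take i v)}"

lemma flag_diff_commute: "flag_diff u v = flag_diff v u"
  by (auto simp: flag_diff_def)

text \<open>At index 0 both segments are empty, and from index \<open>n\<close> on both are the full
  set. This is why leaving the index unbounded in \<open>flag_diff\<close> agrees with the bounded
  index in \<open>FJ\<close>.\<close>

lemma flag_diff_subset:
  assumes "length u = n" "length v = n" "set u = set v"
  shows "flag_diff u v \<subseteq> {1..<n}"
proof
  fix i assume i: "i \<in> flag_diff u v"
  have "i \<noteq> 0"
    using i by (intro notI) (simp add: flag_diff_def)
  moreover have "\<not> n \<le> i"
    using i assms by (auto simp: flag_diff_def)
  ultimately show "i \<in> {1..<n}" by simp
qed

text \<open>In a distinct list, the entry at index \<open>i\<close> is the only element gained in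
  passing from the segment of length \<open>i\<close> to the next one, so the chain of segments
  determines the list.\<close>

lemma flag_diff_empty_iff:
  assumes "distinct u" "distinct v" "length u = length v"
  shows "flag_diff u v = {} \<longleftrightarrow> u = v"
proof
  assume eq: "flag_diff u v = {}"
  have diff: "set (take (Suc i) w) - set (take i w) = {w ! i}"
    if "distinct w" "i < length w" for w :: "'a list" and i
    using that by (auto simp: take_Suc_conv_app_nth in_set_conv_nth nth_eq_iff_index_eq)
  show "u = v"
  proof (rule nth_equalityI)
    fix i assume "i < length u"
    then have "{u ! i} = {v ! i}"
      using diff[of u i] diff[of v i] eq assms by (simp add: flag_diff_def)
    then show "u ! i = v ! i" by simp
  qed (fact assms)
qed (simp add: flag_diff_def)

lemma set_adj_transposition [simp]:
  assumes "1 \<le> x" "x < length u"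
  shows "set (adj_transposition x u) = set u"
  using assms by (simp add: adj_transposition_def)

lemma distinct_adj_transposition [simp]:
  assumes "1 \<le> x" "x < length u"
  shows "distinct (adj_transposition x u) = distinct u"
  using assms by (simp add: adj_transposition_def)

lemma length_adj_transposition [simp]: "length (adj_transposition x u) = length u"
  by (simp add: adj_transposition_def)

text \<open>The swapped entries have list indices \<open>x - 1\<close> and \<open>x\<close>; a
  prefix of length \<open>i\<close> contains both or neither of them unless
  \<open>i = x\<close>.\<close>

lemma set_take_adj_transposition:
  assumes "1 \<le> x" "x < length u"
  shows "i \<noteq> x \<Longrightarrow> set (take i (adj_transposition x u)) = set (take i u)"
    and "set (take x (adj_transposition x u)) = insert (u ! x) (set (take (x - 1) u))"
proof -
  show "set (take i (adj_transposition x u)) = set (take i u)" if "i \<noteq> x"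
  proof (cases "i < x")
    case True
    then show ?thesis by (simp add: adj_transposition_def)
  next
    case False
    then have "x < i" using that by simp
    \<comment> \<open>Both swapped indices lie inside the prefix, so truncation commutes with the
      swap.\<close>
    then have "take i (adj_transposition x u) = adj_transposition x (take i u)"
      using assms by (simp add: adj_transposition_def take_update_swap)
    then show ?thesis using \<open>x < i\<close> assms by simp
  qed
  obtain y where "x = Suc y" using assms by (cases x) auto
  then show "set (take x (adj_transposition x u)) = insert (u ! x) (set (take (x - 1) u))"
    using assms by (simp add: adj_transposition_def take_Suc_conv_app_nth)
qed

lemma flag_diff_adj_transposition:
  assumes "distinct u" "1 \<le> x" "x < length u"
  shows "flag_diff u (adj_transposition x u) = {x}"
proof -
  have "u ! x \<notin> set (take x u)"
    using assms by (auto simp: in_set_conv_nth nth_eq_iff_index_eq)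
  then have "set (take x u) \<noteq> set (take x (adj_transposition x u))"
    using set_take_adj_transposition(2)[of x u] assms by auto
  then show ?thesis
    using set_take_adj_transposition(1)[of x u] assms by (auto simp: flag_diff_def)
qed

text \<open>If only the segments of length \<open>x\<close> differ, then \<open>v ! (x - 1)\<close>
  lies in the segment of length \<open>x + 1\<close> of \<open>u\<close> but not in that of length
  \<open>x - 1\<close>, so it is \<open>u ! (x - 1)\<close> or \<open>u ! x\<close>. The former
  would make the segments of length \<open>x\<close> agree. With the latter, \<open>v\<close> and
  the transposed \<open>u\<close> have the same segments throughout.\<close>

lemma flag_diff_singleton_iff:
  assumes "distinct u" "distinct v" "length u = length v" "1 \<le> x" "x < length u"
  shows "flag_diff u v = {x} \<longleftrightarrow> v = adj_transposition x u"
proof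
  assume D: "flag_diff u v = {x}"
  let ?w = "adj_transposition x u" and ?P = "set (take (x - 1) u)"
  obtain y where y: "x = Suc y" using assms by (cases x) auto
  have eq: "set (take i u) = set (take i v)" if "i \<noteq> x" for i
    using D that by (auto simp: flag_diff_def)
  have u: "set (take x u) = insert (u ! y) ?P" "set (take (Suc x) u) = {u ! x, u ! y} \<union> ?P"
    using assms y by (auto simp: take_Suc_conv_app_nth)
  have v: "set (take x v) = insert (v ! y) ?P"
    using assms y eq[of y] by (simp add: take_Suc_conv_app_nth)
  have "v ! y \<notin> ?P"
    using assms y eq[of y] by (auto simp: in_set_conv_nth nth_eq_iff_index_eq)
  moreover have "v ! y \<in> {u ! x, u ! y} \<union> ?P"
  proof -
    have "v ! y \<in> set (take (Suc x) v)"
      using assms y by (simp add: take_Suc_conv_app_nth)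
    then show ?thesis using eq[of "Suc x"] u by simp
  qed
  moreover have "v ! y \<noteq> u ! y"
  proof -
    have "x \<in> flag_diff u v" using D by simp
    then show ?thesis using u v by (auto simp: flag_diff_def)
  qed
  ultimately have "v ! y = u ! x" by auto
  then have "set (take x v) = set (take x ?w)"
    using v set_take_adj_transposition(2)[of x u] assms by simp
  then have "set (take i v) = set (take i ?w)" for i
    using eq[of i] set_take_adj_transposition(1)[of x u i] assms by (cases "i = x") auto
  then have "flag_diff v ?w = {}"
    by (simp add: flag_diff_def)
  moreover have "distinct ?w" "length v = length ?w"
    using assms by simp_all
  ultimately show "v = ?w"
    using flag_diff_empty_iff[of v ?w] assms(2) by blast
qed (use assms flag_diff_adj_transposition in blast)

section \<open>Initial segments after inserting the largest entry\<close>

lemma length_insertion [simp]: "length (insertion i u) = Suc (length u)"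
  by (simp add: insertion_def)

lemma set_take_insertion:
  assumes "i \<in> {1..length u + 1}"
  shows "set (take m (insertion i u)) =
    (if m < i then set (take m u) else insert (length u + 1) (set (take (m - 1) u)))"
proof (cases "m < i")
  case True
  then show ?thesis using assms by (auto simp: insertion_def min_def)
next
  case False
  \<comment> \<open>The prefix splits into the \<open>i - 1\<close> entries before the new one, the
    new entry itself, and \<open>d\<close> entries after it.\<close>
  then obtain d where m: "m = i + d" by (metis le_add_diff_inverse not_less)
  obtain k where k: "i = Suc k" using assms by (cases i) auto
  have "take m (insertion i u) = take k u @ (length u + 1) # take d (drop k u)"
    using assms m k by (simp add: insertion_def)
  moreover have "take (m - 1) u = take k u @ take d (drop k u)"
    using m k by (simp add: take_add)
  ultimately show ?thesis using False by simp
qed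

lemma flag_diff_insertion:
  assumes "length u = n" "length v = n" "Suc n \<notin> set u" "Suc n \<notin> set v"
    and "1 \<le> i" "i \<le> j" "j \<le> n + 1"
  shows "flag_diff (insertion i u) (insertion j v) =
    flag_diff u v \<inter> {..<i} \<union> {i..<j} \<union> Suc ` (flag_diff u v \<inter> {j - 1..})"
proof (rule Set.set_eqI)
  fix m
  have notin: "Suc n \<notin> set (take k u)" "Suc n \<notin> set (take k v)" for k
    using assms by (auto dest: in_set_takeD)
  consider "m < i" | "i \<le> m" "m < j" | "j \<le> m" by linarith
  then show "m \<in> flag_diff (insertion i u) (insertion j v) \<longleftrightarrow>
    m \<in> flag_diff u v \<inter> {..<i} \<union> {i..<j} \<union> Suc ` (flag_diff u v \<inter> {j - 1..})"
  proof cases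
    case 1
    then show ?thesis using assms by (auto simp: flag_diff_def set_take_insertion)
  next
    case 2
    then show ?thesis
      using assms notin[of m] by (auto simp: flag_diff_def set_take_insertion)
  next
    case 3
    then obtain k where "m = Suc k" using assms by (cases m) auto
    then show ?thesis
      \<comment> \<open>Both segments contain \<open>Suc n\<close>, which lies in neither segment of
        length \<open>k\<close>, so it cancels and the comparison moves down from \<open>m\<close>
        to \<open>k = m - 1\<close>.\<close>
      using 3 assms notin[of k] insert_ident[OF notin(1)[of k] notin(2)[of k]]
      by (auto simp: flag_diff_def set_take_insertion)
  qed
qed

text \<open>The first two pieces lie below \<open>j\<close> and are separated at \<open>i\<close>,
  while the shifted piece starts at \<open>j\<close>. The pieces are therefore disjoint, and since
  \<open>Suc\<close> is injective their cardinalities add.\<close>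

lemma card_flag_diff_insertion:
  assumes "length u = n" "length v = n" "set u = set v" "Suc n \<notin> set u"
    and "1 \<le> i" "i \<le> j" "j \<le> n + 1"
  shows "card (flag_diff (insertion i u) (insertion j v)) =
    card (flag_diff u v \<inter> {..<i}) + (j - i) + card (flag_diff u v \<inter> {j - 1..})"
proof -
  have "flag_diff u v \<subseteq> {1..<n}"
    using assms by (intro flag_diff_subset)
  then have fin: "finite (flag_diff u v)"
    by (rule finite_subset) simp
  let ?A = "flag_diff u v \<inter> {..<i}" and ?B = "flag_diff u v \<inter> {j - 1..}"
  have "Suc n \<notin> set v" using assms by simp
  then have eq: "flag_diff (insertion i u) (insertion j v) = (?A \<union> {i..<j}) \<union> Suc ` ?B"
    using assms by (intro flag_diff_insertion)
  have "?A \<union> {i..<j} \<subseteq> {..<j}"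
    using \<open>i \<le> j\<close> by (intro Un_least subsetI) simp_all
  moreover have "Suc ` ?B \<subseteq> {j..}"
    by (intro image_subsetI) (simp, linarith)
  moreover have "{..<j} \<inter> {j..} = {}"
    by auto
  ultimately have disjoint: "(?A \<union> {i..<j}) \<inter> Suc ` ?B = {}"
    by blast
  have "card (?A \<union> {i..<j}) = card ?A + card {i..<j}"
    by (rule card_Un_disjoint) (use fin in auto)
  moreover have "card ((?A \<union> {i..<j}) \<union> Suc ` ?B) = card (?A \<union> {i..<j}) + card (Suc ` ?B)"
    by (rule card_Un_disjoint[OF _ _ disjoint]) (use fin in simp_all)
  moreover have "card (Suc ` ?B) = card ?B"
    by (simp add: card_image)
  ultimately show ?thesis
    unfolding eq by simp
qed

section \<open>When two insertions differ in exactly one initial segment\<close>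

lemma permutation_atLeastAtMostD:
  assumes "u \<in> permutations_of_set {1..n}"
  shows "distinct u" "set u = {1..n}" "length u = n"
  using assms permutations_of_setD[OF assms] length_finite_permutations_of_set[OF assms]
  by simp_all

lemma flag_diff_permutations_subset:
  assumes "u \<in> permutations_of_set {1..n}" "v \<in> permutations_of_set {1..n}"
  shows "flag_diff u v \<subseteq> {1..<n}"
  using assms[THEN permutation_atLeastAtMostD(2)] assms[THEN permutation_atLeastAtMostD(3)]
  by (intro flag_diff_subset) auto

lemma adj_transposition_permutation:
  assumes "u \<in> permutations_of_set {1..n}" "x \<in> {1..<n}"
  shows "adj_transposition x u \<in> permutations_of_set {1..n}"
  using permutation_atLeastAtMostD[OF assms(1)] assms(2)
  by (intro permutations_of_setI) simp_all

text \<open>The ranges \<open>{..<i}\<close> and \<open>{i..}\<close> partition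
  \<open>flag_diff u v\<close>, and the interval adds 1. The total is 1 only if
  \<open>flag_diff u v\<close> is empty.\<close>

lemma card_flag_diff_insertion_adjacent:
  assumes u: "u \<in> permutations_of_set {1..n}" and v: "v \<in> permutations_of_set {1..n}"
    and i: "1 \<le> i" "i \<le> n"
  shows "card (flag_diff (insertion i u) (insertion (Suc i) v)) = 1 \<longleftrightarrow> u = v"
proof -
  let ?D = "flag_diff u v"
  have "finite ?D"
    using flag_diff_permutations_subset[OF u v] by (rule finite_subset) simp
  moreover have "?D = ?D \<inter> {..<i} \<union> ?D \<inter> {i..}"
    by auto
  ultimately have "card (?D \<inter> {..<i}) + card (?D \<inter> {i..}) = 0 \<longleftrightarrow> ?D = {}"
    by auto
  then show ?thesis
    using permutation_atLeastAtMostD[OF u] permutation_atLeastAtMostD[OF v] i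
    by (simp add: card_flag_diff_insertion[where n = n] flag_diff_empty_iff)
qed

text \<open>The interval alone contributes \<open>j - i\<close>, which is at least 2.\<close>

lemma card_flag_diff_insertion_distant:
  assumes u: "u \<in> permutations_of_set {1..n}" and v: "v \<in> permutations_of_set {1..n}"
    and "1 \<le> i" "Suc i < j" "j \<le> n + 1"
  shows "card (flag_diff (insertion i u) (insertion j v)) \<noteq> 1"
  using permutation_atLeastAtMostD[OF u] permutation_atLeastAtMostD[OF v] assms(3-)
  by (simp add: card_flag_diff_insertion[where n = n])

lemma card_flag_diff_insertion_same:
  assumes u: "u \<in> permutations_of_set {1..n}" and v: "v \<in> permutations_of_set {1..n}"
    and i: "1 \<le> i" "i \<le> n + 1"
  shows "card (flag_diff (insertion i u) (insertion i v)) = 1 \<longleftrightarrow>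
    (\<exists>x \<in> {1..<n} - {i - 1}. flag_diff u v = {x})"
proof -
  let ?D = "flag_diff u v" and ?E = "if i - 1 \<in> flag_diff u v then {i - 1} else {}"
  have sub: "?D \<subseteq> {1..<n}"
    using u v by (rule flag_diff_permutations_subset)
  then have fin: "finite ?D"
    by (rule finite_subset) simp
  \<comment> \<open>By inclusion-exclusion: the two ranges cover all indices and overlap only in
    \<open>i - 1\<close>, so \<open>?E\<close> records the element counted twice.\<close>
  have "card (?D \<inter> {..<i}) + card (?D \<inter> {i - 1..}) =
      card (?D \<inter> {..<i} \<union> ?D \<inter> {i - 1..}) + card (?D \<inter> {..<i} \<inter> (?D \<inter> {i - 1..}))"
    using fin by (intro card_Un_Int) auto
  also have "?D \<inter> {..<i} \<union> ?D \<inter> {i - 1..} = ?D"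
    by auto
  also have "?D \<inter> {..<i} \<inter> (?D \<inter> {i - 1..}) = ?E"
  proof -
    have "x < i \<and> i - 1 \<le> x \<longleftrightarrow> x = i - 1" for x
      using i by linarith
    then have "?D \<inter> {..<i} \<inter> (?D \<inter> {i - 1..}) = {x \<in> ?D. x = i - 1}" by blast
    also have "\<dots> = ?E" by auto
    finally show ?thesis .
  qed
  finally have "card (flag_diff (insertion i u) (insertion i v)) = card ?D + card ?E"
    using permutation_atLeastAtMostD[OF u] permutation_atLeastAtMostD[OF v] i
    by (simp add: card_flag_diff_insertion[where n = n])
  \<comment> \<open>If \<open>i - 1\<close> is in \<open>?D\<close>, then both summands are at least
    1 and the total exceeds 1.\<close>
  moreover have "card ?D \<noteq> 0" if "i - 1 \<in> ?D"
    using that fin by auto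
  ultimately have "card (flag_diff (insertion i u) (insertion i v)) = 1 \<longleftrightarrow>
      card ?D = 1 \<and> i - 1 \<notin> ?D"
    by auto
  also have "\<dots> \<longleftrightarrow> (\<exists>x \<in> {1..<n} - {i - 1}. ?D = {x})"
    using sub by (auto simp: card_1_singleton_iff)
  finally show ?thesis .
qed

section \<open>Arcs, regularity and subgraphs of the Cayley graphs\<close>

lemma verts_FJ [simp]: "pverts (FJ n k) = permutations_of_set {1..n}"
  by (simp add: FJ_def)

lemma arcs_FJ_iff:
  "(u, v) \<in> parcs (FJ n k) \<longleftrightarrow> u \<in> permutations_of_set {1..n} \<and>
     v \<in> permutations_of_set {1..n} \<and> card (flag_diff u v) = k"
proof -
  have eq: "{i \<in> {1..n}. set (take i u) \<noteq> set (take i v)} = flag_diff u v"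
    if "u \<in> permutations_of_set {1..n}" "v \<in> permutations_of_set {1..n}"
    using flag_diff_permutations_subset[OF that] by (auto simp: flag_diff_def)
  have iff: "(u, v) \<in> parcs (FJ n k) \<longleftrightarrow> u \<in> permutations_of_set {1..n} \<and>
      v \<in> permutations_of_set {1..n} \<and> card {i \<in> {1..n}. set (take i u) \<noteq> set (take i v)} = k"
    by (simp add: FJ_def)
  show ?thesis
  proof (cases "u \<in> permutations_of_set {1..n} \<and> v \<in> permutations_of_set {1..n}")
    case True
    then show ?thesis unfolding iff using eq by (simp only:)
  next
    case False
    then show ?thesis unfolding iff by blast
  qed
qed

lemma verts_cayley_graph [simp]: "pverts (cayley_graph n T) = permutations_of_set {1..n}"
  by (simp add: cayley_graph_def)

text \<open>Expressing adjacency through \<open>flag_diff\<close> makes these graphs directly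
  comparable with \<open>FJ\<close> and with the entries of the blocks.\<close>

lemma arcs_cayley_graph_iff:
  assumes "X \<subseteq> {1..<n}"
  shows "(u, v) \<in> parcs (cayley_graph n (adj_transposition ` X)) \<longleftrightarrow>
    u \<in> permutations_of_set {1..n} \<and> v \<in> permutations_of_set {1..n} \<and>
    (\<exists>x \<in> X. flag_diff u v = {x})"
proof -
  have "flag_diff u v = {x} \<longleftrightarrow> v = adj_transposition x u"
    if u: "u \<in> permutations_of_set {1..n}" and v: "v \<in> permutations_of_set {1..n}"
      and "x \<in> X" for x
    using permutation_atLeastAtMostD[OF u] permutation_atLeastAtMostD[OF v] that(3) assms
    by (intro flag_diff_singleton_iff) auto
  then show ?thesis by (auto simp: cayley_graph_def)
qed

lemma FJ_1_eq_cayley_graph: "FJ n 1 = cayley_graph n (adj_transposition ` {1..<n})"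
proof (rule pair_pre_digraph.equality)
  have "(u, v) \<in> parcs (FJ n 1) \<longleftrightarrow> (u, v) \<in> parcs (cayley_graph n (adj_transposition ` {1..<n}))"
    for u v
  proof -
    have "card (flag_diff u v) = 1 \<longleftrightarrow> (\<exists>x \<in> {1..<n}. flag_diff u v = {x})"
      if "u \<in> permutations_of_set {1..n}" "v \<in> permutations_of_set {1..n}"
      using flag_diff_permutations_subset[OF that] by (auto simp: card_1_singleton_iff)
    then show ?thesis
      unfolding arcs_FJ_iff arcs_cayley_graph_iff[OF order_refl] by auto
  qed
  then show "parcs (FJ n 1) = parcs (cayley_graph n (adj_transposition ` {1..<n}))"
    by auto
qed simp_all

text \<open>Symmetry is inherited from \<open>flag_diff\<close>, and there are no loops because
  \<open>flag_diff u u\<close> is empty rather than a singleton.\<close>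

lemma graph_cayley_graph:
  assumes "X \<subseteq> {1..<n}"
  shows "graph (cayley_graph n (adj_transposition ` X))" (is "graph ?G")
proof -
  let ?H = "cayley_graph n (adj_transposition ` X)"
  have arcs: "parcs ?H \<subseteq> permutations_of_set {1..n} \<times> permutations_of_set {1..n}"
    by (auto simp: cayley_graph_def)
  have "pair_graph ?H"
  proof unfold_locales
    show "fst e \<in> pverts ?H" "snd e \<in> pverts ?H" if "e \<in> parcs ?H" for e
      using arcs that by auto
    show "finite (pverts ?H)" by simp
    show "finite (parcs ?H)"
      using arcs by (rule finite_subset) simp
    have "(v, u) \<in> parcs ?H" if "(u, v) \<in> parcs ?H" for u v
      using that unfolding arcs_cayley_graph_iff[OF assms] flag_diff_commute[of v u] by blast
    then show "symmetric ?G"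
      unfolding symmetric_def with_proj_simps by (rule symI)
    show "fst e \<noteq> snd e" if "e \<in> parcs ?H" for e
    proof
      assume "fst e = snd e"
      then have "flag_diff (fst e) (snd e) = {}" by (simp add: flag_diff_def)
      moreover have "\<exists>x \<in> X. flag_diff (fst e) (snd e) = {x}"
        using that arcs_cayley_graph_iff[OF assms, of "fst e" "snd e"] by simp
      ultimately show False by simp
    qed
  qed
  then show ?thesis by (rule pair_graph.pair_graphD_graph)
qed

text \<open>Different transpositions lead from \<open>u\<close> to different neighbours, because
  \<open>x\<close> can be recovered as the only element of
  \<open>flag_diff u (adj_transposition x u)\<close>.\<close>

lemma regular_cayley_graph:
  assumes "X \<subseteq> {1..<n}"
  shows "regular_graph (cayley_graph n (adj_transposition ` X)) (card X)"
  unfolding regular_graph_def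
proof (intro conjI ballI graph_cayley_graph assms)
  fix u assume "u \<in> verts (cayley_graph n (adj_transposition ` X))"
  then have u: "u \<in> permutations_of_set {1..n}" by simp
  have "flag_diff u (adj_transposition x u) = {x}" if "x \<in> X" for x
    using permutation_atLeastAtMostD[OF u] that assms by (intro flag_diff_adj_transposition) auto
  then have "inj_on (\<lambda>x. (u, adj_transposition x u)) X"
    by (intro inj_onI) (metis prod.inject singleton_inject)
  moreover have "out_arcs (cayley_graph n (adj_transposition ` X)) u =
      (\<lambda>x. (u, adj_transposition x u)) ` X"
    using u assms adj_transposition_permutation[OF u]
    by (auto simp: out_arcs_def cayley_graph_def)
  ultimately show "out_degree (cayley_graph n (adj_transposition ` X)) u = card X"
    by (simp add: out_degree_def card_image)
qed

lemma subgraph_cayley_graph: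
  assumes "X \<subseteq> Y" "Y \<subseteq> {1..<n}"
  shows "subgraph (cayley_graph n (adj_transposition ` X)) (cayley_graph n (adj_transposition ` Y))"
proof -
  interpret X: graph "cayley_graph n (adj_transposition ` X)"
    using assms by (intro graph_cayley_graph) auto
  interpret Y: graph "cayley_graph n (adj_transposition ` Y)"
    using assms by (intro graph_cayley_graph)
  show ?thesis
    using assms(1) X.wf_digraph Y.wf_digraph
    by (auto simp: subgraph_def compatible_def cayley_graph_def)
qed

section \<open>Insertion on permutations and the ordering \<open>S_bar\<close>\<close>

lemma insertion_permutation:
  assumes "u \<in> permutations_of_set {1..n}"
  shows "insertion i u \<in> permutations_of_set {1..n + 1}"
proof (rule permutations_of_setI)
  note u = permutation_atLeastAtMostD[OF assms]
  have "set (insertion i u) = insert (length u + 1) (set (take (i - 1) u @ drop (i - 1) u))"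
    unfolding insertion_def set_append by auto
  also have "\<dots> = insert (n + 1) {1..n}"
    unfolding append_take_drop_id using u by simp
  also have "\<dots> = {1..n + 1}"
    by auto
  finally show set: "set (insertion i u) = {1..n + 1}" .
  \<comment> \<open>A list of length \<open>n + 1\<close> with \<open>n + 1\<close> different
    entries has no repetition.\<close>
  then show "distinct (insertion i u)"
    using u by (intro card_distinct) simp
qed

text \<open>Deleting \<open>n + 1\<close> from \<open>w\<close> leaves \<open>u\<close>, and the
  position of \<open>n + 1\<close>, counted from 1, is \<open>i\<close>.\<close>

lemma insertion_surj:
  assumes w: "w \<in> permutations_of_set {1..n + 1}"
  obtains i u where "i \<in> {1..n + 1}" "u \<in> permutations_of_set {1..n}" "w = insertion i u"
proof -
  note wD = permutation_atLeastAtMostD[OF w]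
  have "n + 1 \<in> set w" using wD by simp
  then obtain xs ys where split: "w = xs @ (n + 1) # ys" by (meson split_list)
  have "set (xs @ ys) = {1..n + 1} - {n + 1}"
    using wD split by auto
  also have "\<dots> = {1..n}" by auto
  finally have "set (xs @ ys) = {1..n}" .
  then have "xs @ ys \<in> permutations_of_set {1..n}"
    using wD split by (intro permutations_of_setI) auto
  moreover have "length xs + length ys = n"
    using wD split by simp
  ultimately show ?thesis
    using split by (intro that[of "length xs + 1" "xs @ ys"]) (auto simp: insertion_def)
qed

lemma nth_concat_equal_length:
  assumes "\<forall>xs \<in> set xss. length xs = m" "i < length xss" "k < m"
  shows "concat xss ! (i * m + k) = xss ! i ! k"
  using assms
proof (induction xss arbitrary: i)
  case (Cons xs xss)
  then show ?case
    by (cases i) (simp_all add: nth_append add.assoc)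
qed simp

lemma length_S_bar: "length (S_bar n S) = (n + 1) * length S"
  by (simp add: S_bar_def length_concat o_def sum_list_triv del: upt_Suc)

lemma nth_S_bar:
  assumes "i \<in> {1..n + 1}" "k < length S"
  shows "S_bar n S ! ((i - 1) * length S + k) = insertion i (S ! k)"
proof -
  have "S_bar n S ! ((i - 1) * length S + k) =
      map (\<lambda>i. map (insertion i) S) [1..<n + 2] ! (i - 1) ! k"
    unfolding S_bar_def using assms by (intro nth_concat_equal_length) auto
  moreover obtain d where "i = Suc d" "d \<le> n"
    using assms by (cases i) auto
  ultimately show ?thesis using assms by (simp del: upt_Suc)
qed

lemma length_vertex_ordering_FJ:
  assumes "vertex_ordering (FJ n 1) S"
  shows "length S = fact n"
proof -
  have "length S = card (permutations_of_set {1..n})"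
    using assms distinct_card[of S] by (simp add: vertex_ordering_def)
  then show ?thesis by simp
qed

text \<open>Distinctness follows by counting, without injectivity of insertion: the list covers all
  permutations of \<open>{1..n + 1}\<close>, and its length \<open>(n + 1) * fact n\<close> is
  exactly their number.\<close>

lemma vertex_ordering_S_bar:
  assumes "vertex_ordering (FJ n 1) S"
  shows "vertex_ordering (FJ (n + 1) 1) (S_bar n S)"
proof -
  have S: "set S = permutations_of_set {1..n}"
    using assms by (simp add: vertex_ordering_def)
  have "set (S_bar n S) = (\<Union>i \<in> {1..n + 1}. insertion i ` set S)"
  proof -
    have "{1..<n + 2} = {1..n + 1}" by auto
    then show ?thesis unfolding S_bar_def set_concat set_map set_upt by simp
  qed
  also have "\<dots> = permutations_of_set {1..n + 1}"
    unfolding S by (blast intro: insertion_permutation elim: insertion_surj)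
  finally have set: "set (S_bar n S) = permutations_of_set {1..n + 1}" .
  then have "card (set (S_bar n S)) = length (S_bar n S)"
    by (simp add: length_S_bar length_vertex_ordering_FJ[OF assms])
  then show ?thesis
    using set by (simp add: vertex_ordering_def card_distinct)
qed

section \<open>Entries of a block in terms of the whole matrix\<close>

lemma pick_atLeastLessThan:
  assumes "k < b - a"
  shows "pick {a..<b} k = a + k"
proof -
  \<comment> \<open>Exactly \<open>k\<close> elements of the interval lie below
    \<open>a + k\<close>, so \<open>a + k\<close> is the element that \<open>pick\<close> returns
    for index \<open>k\<close>.\<close>
  have "{x \<in> {a..<b}. x < a + k} = {a..<a + k}"
    using assms by auto
  then show ?thesis
    using pick_card_in_set[of "a + k" "{a..<b}"] assms by simp
qed

lemma block_eq:
  assumes M: "M \<in> carrier_mat (N * m) (N * m)" and i: "i \<in> {1..N}" and j: "j \<in> {1..N}"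
  shows "block m M i j = mat m m (\<lambda>(k, l). M $$ ((i - 1) * m + k, (j - 1) * m + l))"
proof -
  \<comment> \<open>\<open>submatrix\<close> keeps only indices within the dimensions of
    \<open>M\<close>. The bound \<open>i \<le> N\<close> ensures that nothing is cut off, so each
    block has full size \<open>m\<close>.\<close>
  have interval: "{x. x < N * m \<and> x \<in> {(i - 1) * m..<i * m}} = {(i - 1) * m..<i * m}"
      "i * m - (i - 1) * m = m" if "i \<in> {1..N}" for i
  proof -
    have "i * m \<le> N * m" using that by (intro mult_le_mono1) simp
    then have "{(i - 1) * m..<i * m} \<subseteq> {..<N * m}"
      by (intro subsetI) (simp only: atLeastLessThan_iff lessThan_iff, linarith)
    then show "{x. x < N * m \<and> x \<in> {(i - 1) * m..<i * m}} = {(i - 1) * m..<i * m}" by blast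
    show "i * m - (i - 1) * m = m" using that by (cases i) auto
  qed
  show ?thesis
    using M interval[OF i] interval[OF j]
    by (intro eq_matI) (simp_all add: block_def submatrix_def pick_atLeastLessThan del: atLeastLessThan_iff)
qed

text \<open>This reduces every statement about blocks to the cardinality of \<open>flag_diff\<close>
  for two insertions.\<close>

lemma block_S_bar:
  assumes S: "vertex_ordering (FJ n 1) S" and i: "i \<in> {1..n + 1}" and j: "j \<in> {1..n + 1}"
  shows "block (fact n) (adjacency_matrix (FJ (n + 1) 1) (S_bar n S)) i j =
    mat (fact n) (fact n) (\<lambda>(k, l).
      if card (flag_diff (insertion i (S ! k)) (insertion j (S ! l))) = 1 then 1 else 0)"
proof -
  let ?A = "adjacency_matrix (FJ (n + 1) 1) (S_bar n S)"
  note len = length_vertex_ordering_FJ[OF S]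
  have "?A \<in> carrier_mat ((n + 1) * fact n) ((n + 1) * fact n)"
    by (simp add: adjacency_matrix_def length_S_bar len)
  then have "block (fact n) ?A i j =
      mat (fact n) (fact n) (\<lambda>(k, l). ?A $$ ((i - 1) * fact n + k, (j - 1) * fact n + l))"
    using i j by (rule block_eq)
  also have "\<dots> = mat (fact n) (fact n) (\<lambda>(k, l).
      if card (flag_diff (insertion i (S ! k)) (insertion j (S ! l))) = 1 then 1 else 0)"
  proof (rule eq_matI)
    fix k l
    assume "k < dim_row (mat (fact n) (fact n) (\<lambda>(k, l).
        if card (flag_diff (insertion i (S ! k)) (insertion j (S ! l))) = 1 then 1 else 0 :: real))"
      "l < dim_col (mat (fact n) (fact n) (\<lambda>(k, l).
        if card (flag_diff (insertion i (S ! k)) (insertion j (S ! l))) = 1 then 1 else 0 :: real))"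
    then have kl: "k < fact n" "l < fact n" by simp_all
    \<comment> \<open>Row and column numbers must stay within the matrix, since its entries are
      specified only there.\<close>
    have idx: "(i - 1) * fact n + k < (n + 1) * fact n"
      if "i \<in> {1..n + 1}" "k < fact n" for i k :: nat
    proof -
      have "(i - 1) * fact n + k < i * fact n" using that by (cases i) auto
      also have "\<dots> \<le> (n + 1) * fact n" using that by (intro mult_le_mono1) simp
      finally show ?thesis .
    qed
    have perm: "S ! k \<in> permutations_of_set {1..n}" if "k < fact n" for k
      using S len that nth_mem[of k S] by (simp add: vertex_ordering_def)
    have "S_bar n S ! ((i - 1) * fact n + k) = insertion i (S ! k)"
      "S_bar n S ! ((j - 1) * fact n + l) = insertion j (S ! l)"
      using nth_S_bar[OF i, of k S] nth_S_bar[OF j, of l S] kl len by simp_all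
    then show "mat (fact n) (fact n)
        (\<lambda>(k, l). ?A $$ ((i - 1) * fact n + k, (j - 1) * fact n + l)) $$ (k, l) =
      mat (fact n) (fact n) (\<lambda>(k, l).
        if card (flag_diff (insertion i (S ! k)) (insertion j (S ! l))) = 1 then 1 else 0) $$ (k, l)"
      using kl idx[OF i kl(1)] idx[OF j kl(2)] insertion_permutation[OF perm[OF kl(1)]]
        insertion_permutation[OF perm[OF kl(2)]]
      by (simp add: adjacency_matrix_def length_S_bar len arcs_FJ_iff)
  qed simp_all
  finally show ?thesis .
qed

section \<open>The blocks next to, away from and on the diagonal\<close>

lemma block_S_bar_adjacent:
  assumes S: "vertex_ordering (FJ n 1) S" and i: "i \<in> {1..n + 1}" and j: "j \<in> {1..n + 1}"
    and "j = Suc i \<or> i = Suc j"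
  shows "block (fact n) (adjacency_matrix (FJ (n + 1) 1) (S_bar n S)) i j = 1\<^sub>m (fact n)"
proof -
  have "card (flag_diff (insertion i (S ! k)) (insertion j (S ! l))) = 1 \<longleftrightarrow> k = l"
    if "k < fact n" "l < fact n" for k l
  proof -
    have "S ! k \<in> permutations_of_set {1..n}" "S ! l \<in> permutations_of_set {1..n}"
      using S that length_vertex_ordering_FJ[OF S] nth_mem[of k S] nth_mem[of l S]
      by (simp_all add: vertex_ordering_def)
    \<comment> \<open>The cardinality lemma covers \<open>j = Suc i\<close>; the other case follows
      by exchanging the two permutations.\<close>
    then have "card (flag_diff (insertion i (S ! k)) (insertion j (S ! l))) = 1 \<longleftrightarrow> S ! k = S ! l"
      using assms(4) i j card_flag_diff_insertion_adjacent[of "S ! k" n "S ! l" i]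
        card_flag_diff_insertion_adjacent[of "S ! l" n "S ! k" j]
      by (auto simp: flag_diff_commute[of "insertion i (S ! k)"])
    then show ?thesis
      using S that length_vertex_ordering_FJ[OF S]
      by (simp add: vertex_ordering_def nth_eq_iff_index_eq)
  qed
  then show ?thesis
    unfolding block_S_bar[OF S i j] by (intro eq_matI) auto
qed

lemma block_S_bar_distant:
  assumes S: "vertex_ordering (FJ n 1) S" and i: "i \<in> {1..n + 1}" and j: "j \<in> {1..n + 1}"
    and "Suc i < j \<or> Suc j < i"
  shows "block (fact n) (adjacency_matrix (FJ (n + 1) 1) (S_bar n S)) i j = 0\<^sub>m (fact n) (fact n)"
proof -
  have "card (flag_diff (insertion i (S ! k)) (insertion j (S ! l))) \<noteq> 1"
    if "k < fact n" "l < fact n" for k l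
  proof -
    have "S ! k \<in> permutations_of_set {1..n}" "S ! l \<in> permutations_of_set {1..n}"
      using S that length_vertex_ordering_FJ[OF S] nth_mem[of k S] nth_mem[of l S]
      by (simp_all add: vertex_ordering_def)
    then show ?thesis
      using assms(4) i j card_flag_diff_insertion_distant[of "S ! k" n "S ! l" i j]
        card_flag_diff_insertion_distant[of "S ! l" n "S ! k" j i]
      by (auto simp: flag_diff_commute[of "insertion i (S ! k)"])
  qed
  then show ?thesis
    unfolding block_S_bar[OF S i j] by (intro eq_matI) auto
qed

text \<open>An entry on either side is 1 exactly when \<open>flag_diff\<close> of the two
  permutations is a singleton \<open>{x}\<close> with \<open>x\<close> in \<open>{1..<n}\<close> and
  different from \<open>i - 1\<close>.\<close>

lemma block_S_bar_same:
  assumes S: "vertex_ordering (FJ n 1) S" and i: "i \<in> {1..n + 1}"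
  shows "block (fact n) (adjacency_matrix (FJ (n + 1) 1) (S_bar n S)) i i =
    adjacency_matrix (cayley_graph n (adj_transposition ` ({1..<n} - {i - 1}))) S"
proof -
  let ?X = "{1..<n} - {i - 1}"
  have "card (flag_diff (insertion i (S ! k)) (insertion i (S ! l))) = 1 \<longleftrightarrow>
      (S ! k, S ! l) \<in> parcs (cayley_graph n (adj_transposition ` ?X))"
    if "k < fact n" "l < fact n" for k l
  proof -
    have "S ! k \<in> permutations_of_set {1..n}" "S ! l \<in> permutations_of_set {1..n}"
      using S that length_vertex_ordering_FJ[OF S] nth_mem[of k S] nth_mem[of l S]
      by (simp_all add: vertex_ordering_def)
    then show ?thesis
      using i card_flag_diff_insertion_same[of "S ! k" n "S ! l" i]
        arcs_cayley_graph_iff[of ?X n "S ! k" "S ! l"] by auto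
  qed
  then show ?thesis
    unfolding block_S_bar[OF S i i]
    by (intro eq_matI) (auto simp: adjacency_matrix_def length_vertex_ordering_FJ[OF S])
qed

theorem theorem6p1:
  fixes n :: nat and S :: "nat list list"
  assumes "n \<ge> 2"
    and "vertex_ordering (FJ n 1) S"
  shows "vertex_ordering (FJ (n + 1) 1) (S_bar n S) \<and>
    (let A = adjacency_matrix (FJ (n + 1) 1) (S_bar n S) in
      (\<forall>i \<in> {1..n + 1}. \<forall>j \<in> {1..n + 1}.
        (\<bar>int i - int j\<bar> = 1 \<longrightarrow> block (fact n) A i j = 1\<^sub>m (fact n)) \<and>
        (\<bar>int i - int j\<bar> > 1 \<longrightarrow> block (fact n) A i j = 0\<^sub>m (fact n) (fact n))) \<and>
      (\<forall>i \<in> {1..n + 1}.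
        (let H = (if i = 1 \<or> i = n + 1 then FJ n 1
                  else cayley_graph n {adj_transposition x | x. x \<in> {1..n - 1} \<and> x \<noteq> i - 1})
         in subgraph H (FJ n 1) \<and>
            regular_graph H (if i = 1 \<or> i = n + 1 then n - 1 else n - 2) \<and>
            block (fact n) A i i = adjacency_matrix H S)))"
proof -
  note S = assms(2)
  let ?A = "adjacency_matrix (FJ (n + 1) 1) (S_bar n S)"
  have offdiagonal:
    "(\<bar>int i - int j\<bar> = 1 \<longrightarrow> block (fact n) ?A i j = 1\<^sub>m (fact n)) \<and>
     (\<bar>int i - int j\<bar> > 1 \<longrightarrow> block (fact n) ?A i j = 0\<^sub>m (fact n) (fact n))"
    if "i \<in> {1..n + 1}" "j \<in> {1..n + 1}" for i j
    by (intro conjI impI block_S_bar_adjacent[OF S that] block_S_bar_distant[OF S that]) linarith+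
  have diagonal: "subgraph H (FJ n 1) \<and>
      regular_graph H (if i = 1 \<or> i = n + 1 then n - 1 else n - 2) \<and>
      block (fact n) ?A i i = adjacency_matrix H S"
    if i: "i \<in> {1..n + 1}"
      and H: "H = (if i = 1 \<or> i = n + 1 then FJ n 1
        else cayley_graph n {adj_transposition x | x. x \<in> {1..n - 1} \<and> x \<noteq> i - 1})" for i H
  proof -
    let ?X = "{1..<n} - {i - 1}"
    \<comment> \<open>Here \<open>i - 1\<close> is 0 or \<open>n\<close>, so nothing is removed. The
      corner blocks thus become instances of the same Cayley graph, and one argument serves both
      forms of \<open>H\<close>.\<close>
    have X: "?X = {1..<n}" if "i = 1 \<or> i = n + 1"
      using that by auto
    have "{adj_transposition x | x. x \<in> {1..n - 1} \<and> x \<noteq> i - 1} = adj_transposition ` ?X"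
    proof -
      have "{1..n - 1} = {1..<n}" using assms(1) by auto
      then show ?thesis by auto
    qed
    then have H': "H = cayley_graph n (adj_transposition ` ?X)"
      using H X FJ_1_eq_cayley_graph[of n] by auto
    have "card ?X = (if i = 1 \<or> i = n + 1 then n - 1 else n - 2)"
    proof (cases "i = 1 \<or> i = n + 1")
      case True
      then show ?thesis using X by simp
    next
      case False
      then have "i - 1 \<in> {1..<n}" using i by auto
      then show ?thesis using False by simp
    qed
    then show ?thesis
      using regular_cayley_graph[of ?X n] subgraph_cayley_graph[of ?X "{1..<n}" n]
        block_S_bar_same[OF S i]
      unfolding H' FJ_1_eq_cayley_graph[of n] by auto
  qed
  show ?thesis
    unfolding Let_def
    by (intro conjI[OF vertex_ordering_S_bar[OF S] conjI] ballI offdiagonal diagonal[OF _ refl])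
qed

end
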